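(* Let $C$ be a non-degenerate conic (an ellipse, a hyperbola, or a parabola) in the complex plane given by $$c(z)=\overline{a}z^2+pz\overline{z}+a\overline{z}^2+\overline{b}z+b\overline{z}+q=0\qquad (a,b\in\mathbb{C},\ p,q\in\mathbb{R}),$$ and for $r>2$, with $r_2=r^2/2$, let $E$ be the ellipse with foci $1$ and $-1$ given by $$e(z)=z^2+(2-2r_2)z\overline{z}+\overline{z}^2+r_2^2-2r_2=0,$$ that is, $E=\{z\in\mathbb{C}: |z-1|+|z+1|=r\}$. Suppose that for some $r>2$ the ellipse $E$ does not coincide with $C$ and has a point of tangency with $C$. Then the point of tangency $z$ is a solution of the equation $$F_4(z)=W_6z^6+W_5z^5+W_4z^4+W_3z^3+W_2z^2+W_1z+W_0=0,$$ where $W_0,\dots,W_6$ are the explicit polynomials in $a,\overline a,b,\overline b,p,q$ written out in the context.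
   Context: The coefficients $W_0,\dots,W_6$ of $F_4$ are as follows. $W_6=4\overline{a}(\overline{b}bp-\overline{b}^2a-\overline{a}b^2)(p^2-4\overline{a}a)$. $W_5=-2\Big[bp^5-\overline{b}(a+\overline{a})p^4-b(4\overline{a}q+8\overline{a}a+\overline{b}^2)p^3+\overline{b}\big(8\overline{a}aq+8\overline{a}a^2+(8\overline{a}^2+\overline{b}^2)a-3\overline{a}b^2\big)p^2+4\overline{a}b(4\overline{a}aq+4\overline{a}a^2+4\overline{b}^2a+\overline{a}b^2)p-4a\overline{a}\overline{b}\big(8\overline{a}aq+4\overline{a}a^2+(4\overline{a}^2+3\overline{b}^2)a+3\overline{a}b^2\big)\Big]$. $W_4=-\Big[p^6-\big((4a+4\overline{a})q+a^2+10\overline{a}a-9b^2+\overline{a}^2+\overline{b}^2\big)p^4-2b\overline{b}(2q+11a+\overline{a})p^3+\Big(16\overline{a}aq^2+4\big(8\overline{a}a^2+(8\overline{a}^2+2\overline{b}^2)a-5\overline{a}b^2\big)q+8\overline{a}a^3+(32\overline{a}^2+14\overline{b}^2)a^2+(-42\overline{a}b^2+8\overline{a}^3+18\overline{b}^2\overline{a})a+(-6\overline{a}^2-5\overline{b}^2)b^2\Big)p^2+2b\overline{b}\big(48\overline{a}aq+44\overline{a}a^2+(4\overline{a}^2+7\overline{b}^2)a+\overline{a}b^2\big)p-64\overline{a}^2a^2q^2-16a^2\overline{a}(4\overline{a}a+4\overline{a}^2+7\overline{b}^2)q-16\overline{a}^2a^4-(32\overline{a}^3+56\overline{b}^2\overline{a})a^3+(24\overline{a}^2b^2-16\overline{a}^4-56\overline{b}^2\overline{a}^2-9\overline{b}^4)a^2+(24\overline{a}^3-6\overline{b}^2\overline{a})b^2a+3\overline{a}^2b^4\Big]$.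 $W_3=-2\Big[2bp^5-\overline{b}(q+4a)p^4-b\big((14a+2\overline{a})q+2a^2+12\overline{a}a-8b^2+2\overline{a}^2+\overline{b}^2\big)p^3+\overline{b}\big(4aq^2+(20a^2+20\overline{a}a-7b^2)q+4a^3+24\overline{a}a^2+(-24b^2+4\overline{a}^2+3\overline{b}^2)a-\overline{a}b^2\big)p^2+b\Big(32\overline{a}aq^2+\big(56\overline{a}a^2+(8\overline{a}^2+26\overline{b}^2)a-6\overline{a}b^2\big)q+8\overline{a}a^3+(16\overline{a}^2+26\overline{b}^2)a^2+(-18\overline{a}b^2+8\overline{a}^3+2\overline{b}^2\overline{a})a+(-6\overline{a}^2-\overline{b}^2)b^2\Big)p-\overline{b}\Big(80\overline{a}a^2q^2+4a\big(20\overline{a}a^2+(16\overline{a}^2+6\overline{b}^2)a-3\overline{a}b^2\big)q+16\overline{a}a^4+(32\overline{a}^2+12\overline{b}^2)a^3+(-28\overline{a}b^2+16\overline{a}^3+16\overline{b}^2\overline{a})a^2+(-24\overline{a}^2-\overline{b}^2)b^2a-\overline{a}b^4\Big)\Big]$. $W_2=2\Big[\big((3a-\overline{a})q-3b^2\big)p^4+b\overline{b}(3q+9a+\overline{a})p^3+\Big(-2(6a^2+2\overline{a}a-b^2)q^2-\big(4a^3+16\overline{a}a^2+(-27b^2-4\overline{a}^2+9\overline{b}^2)a+4\overline{a}b^2\big)q+3(b^2-3\overline{b}^2)a^2+(9\overline{a}b^2-\overline{b}^2\overline{a})a-7b^4+2\overline{a}^2b^2\Big)p^2-b\overline{b}\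big(28aq^2+(60a^2-5b^2)q+8a^3+20\overline{a}a^2-(19b^2-12\overline{a}^2)a-5\overline{a}b^2\big)p+32\overline{a}a^2q^3+4a\big(12\overline{a}a^2+(4\overline{a}^2+11\overline{b}^2)a-3\overline{a}b^2\big)q^2+\big(16\overline{a}a^4+(16\overline{a}^2+44\overline{b}^2)a^3+(-32\overline{a}b^2+40\overline{b}^2\overline{a})a^2-(12\overline{a}^2+9\overline{b}^2)b^2a+\overline{a}b^4\big)q+8\overline{b}^2a^4+(-4\overline{a}b^2+20\overline{b}^2\overline{a})a^3+\big(-(4\overline{a}^2+15\overline{b}^2)b^2+12\overline{b}^2\overline{a}^2+3\overline{b}^4\big)a^2+(5\overline{a}b^4-15\overline{b}^2\overline{a}b^2)a+2\overline{a}^2b^4\Big]$. $W_1=2\Big[2b\big(q^2+(3a-\overline{a})q-b^2\big)p^3-\overline{b}\big(8aq^2+(12a^2-4\overline{a}a+b^2)q-6b^2a-2\overline{a}b^2\big)p^2-b\Big(8aq^3+(32a^2-8\overline{a}a-2b^2)q^2+\big(8a^3+8\overline{a}a^2+(-20b^2-2\overline{b}^2)a+2\overline{a}b^2\big)q+(-2b^2+6\overline{b}^2)a^2+(-2\overline{a}b^2+6\overline{b}^2\overline{a})a+3b^4-\overline{b}^2b^2\Big)p+\overline{b}\Big(32a^2q^3+4a(12a^2+4\overline{a}a-3b^2)q^2+\big(16a^4+16\overline{a}a^3+(-32b^2+8\overline{b}^2)a^2-12\overline{a}b^2a+b^4\big)q+(-4b^2+4\overline{b}^2)a^3+(-4\overline{a}b^2+4\overline{b}^2\overline{a})a^2+(5b^4-3\overline{b}^2b^2)a+2\overline{a}b^4\Big)\Big]$.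 $W_0=q^2p^4-2\overline{b}bqp^3+\big(-8aq^3+(-8a^2+2b^2)q^2+(6b^2+2\overline{b}^2)aq-b^4+\overline{b}^2b^2\big)p^2+2b\overline{b}\big(4aq^2+(-4a^2-b^2)q+(b^2-\overline{b}^2)a\big)p+16a^2q^4+8a(4a^2-b^2)q^3+\big(16a^4+(-32b^2+8\overline{b}^2)a^2+b^4\big)q^2-2a\big((4b^2-4\overline{b}^2)a^2-5b^4+3\overline{b}^2b^2\big)q+(b-\overline{b})(b+\overline{b})\big((b^2-\overline{b}^2)a^2-b^4\big)$. *)

theory Defs
  imports "HOL-Analysis.Analysis"
begin

text \<open>A circle counts as an ellipse (coinciding foci).\<close>

definition is_ellipse :: "complex set \<Rightarrow> bool" where
  "is_ellipse S \<longleftrightarrow> (\<exists>f1 f2 s. dist f1 f2 < s \<and> S = {z. dist z f1 + dist z f2 = s})"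

definition is_hyperbola :: "complex set \<Rightarrow> bool" where
  "is_hyperbola S \<longleftrightarrow>
     (\<exists>f1 f2 s. 0 < s \<and> s < dist f1 f2 \<and> S = {z. \<bar>dist z f1 - dist z f2\<bar> = s})"

text \<open>The directrix is the line \<open>{w. n \<bullet> w = k}\<close>; \<open>infdist z L\<close> is the distance from
  \<open>z\<close> to \<open>L\<close>. The focus must lie off the directrix.\<close>

definition is_parabola :: "complex set \<Rightarrow> bool" where
  "is_parabola S \<longleftrightarrow>
     (\<exists>f n k. n \<noteq> 0 \<and> n \<bullet> f \<noteq> k \<and> S = {z. dist z f = infdist z {w. n \<bullet> w = k}})"

definition nondegenerate_conic :: "complex set \<Rightarrow> bool" where
  "nondegenerate_conic S \<longleftrightarrow> is_ellipse S \<or> is_hyperbola S \<or> is_parabola S"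

definition zero_set :: "(complex \<Rightarrow> complex) \<Rightarrow> complex set" where
  "zero_set f = {z. f z = 0}"

text \<open>Both functions below take only real values.\<close>

definition c_fun :: "complex \<Rightarrow> complex \<Rightarrow> real \<Rightarrow> real \<Rightarrow> complex \<Rightarrow> complex" where
  "c_fun a b p q z =
     cnj a * z^2 + of_real p * z * cnj z + a * (cnj z)^2 + cnj b * z + b * cnj z + of_real q"

definition e_fun :: "real \<Rightarrow> complex \<Rightarrow> complex" where
  "e_fun r z = (let r2 = r^2 / 2 in
     z^2 + of_real (2 - 2 * r2) * z * cnj z + (cnj z)^2 + of_real (r2^2 - 2 * r2))"

text \<open>The derivative is the real one, on the plane \<open>\<complex> = \<real>\<^sup>2\<close>. Where it does not vanish and
  \<open>f\<close> is real-valued, its kernel translated to \<open>z\<close> is the tangent line at \<open>z\<close> of the curve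
  given by \<open>f = 0\<close>.\<close>

definition tangent_line :: "(complex \<Rightarrow> complex) \<Rightarrow> complex \<Rightarrow> complex set" where
  "tangent_line f z = {w. frechet_derivative f (at z) (w - z) = 0}"

definition tangency_point ::
    "(complex \<Rightarrow> complex) \<Rightarrow> (complex \<Rightarrow> complex) \<Rightarrow> complex \<Rightarrow> bool" where
  "tangency_point f g z \<longleftrightarrow>
     z \<in> zero_set f \<and> z \<in> zero_set g \<and>
     frechet_derivative f (at z) \<noteq> (\<lambda>_. 0) \<and> frechet_derivative g (at z) \<noteq> (\<lambda>_. 0) \<and>
     tangent_line f z = tangent_line g z"

text \<open>In the coefficients, \<open>ac\<close> and \<open>bc\<close> stand for the conjugates of \<open>a\<close> and \<open>b\<close>.\<close>

definition W6 :: "complex \<Rightarrow> complex \<Rightarrow> complex \<Rightarrow> complex \<Rightarrow> complex \<Rightarrow> complex \<Rightarrow> complex" where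
  "W6 a ac b bc p q =
     4 * ac * (bc * b * p - bc^2 * a - ac * b^2) * (p^2 - 4 * ac * a)"

definition W5 :: "complex \<Rightarrow> complex \<Rightarrow> complex \<Rightarrow> complex \<Rightarrow> complex \<Rightarrow> complex \<Rightarrow> complex" where
  "W5 a ac b bc p q =
     -2 * (
       b * p^5 - bc * (a + ac) * p^4 - b * (4 * ac * q + 8 * ac * a + bc^2) * p^3
       + bc * (8 * ac * a * q + 8 * ac * a^2 + (8 * ac^2 + bc^2) * a - 3 * ac * b^2) * p^2
       + 4 * ac * b * (4 * ac * a * q + 4 * ac * a^2 + 4 * bc^2 * a + ac * b^2) * p
       - 4 * a * ac * bc * (
         8 * ac * a * q + 4 * ac * a^2 + (4 * ac^2 + 3 * bc^2) * a + 3 * ac * b^2))"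

definition W4 :: "complex \<Rightarrow> complex \<Rightarrow> complex \<Rightarrow> complex \<Rightarrow> complex \<Rightarrow> complex \<Rightarrow> complex" where
  "W4 a ac b bc p q =
     -(
       p^6 - ((4 * a + 4 * ac) * q + a^2 + 10 * ac * a - 9 * b^2 + ac^2 + bc^2) * p^4
       - 2 * b * bc * (2 * q + 11 * a + ac) * p^3
       + (
         16 * ac * a * q^2
         + 4 * (8 * ac * a^2 + (8 * ac^2 + 2 * bc^2) * a - 5 * ac * b^2) * q
         + 8 * ac * a^3 + (32 * ac^2 + 14 * bc^2) * a^2
         + (-42 * ac * b^2 + 8 * ac^3 + 18 * bc^2 * ac) * a + (-6 * ac^2 - 5 * bc^2) * b^2) * p^2
       + 2 * b * bc * (
         48 * ac * a * q + 44 * ac * a^2 + (4 * ac^2 + 7 * bc^2) * a + ac * b^2) * p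
       - 64 * ac^2 * a^2 * q^2 - 16 * a^2 * ac * (4 * ac * a + 4 * ac^2 + 7 * bc^2) * q
       - 16 * ac^2 * a^4 - (32 * ac^3 + 56 * bc^2 * ac) * a^3
       + (24 * ac^2 * b^2 - 16 * ac^4 - 56 * bc^2 * ac^2 - 9 * bc^4) * a^2
       + (24 * ac^3 - 6 * bc^2 * ac) * b^2 * a + 3 * ac^2 * b^4)"

definition W3 :: "complex \<Rightarrow> complex \<Rightarrow> complex \<Rightarrow> complex \<Rightarrow> complex \<Rightarrow> complex \<Rightarrow> complex" where
  "W3 a ac b bc p q =
     -2 * (
       2 * b * p^5 - bc * (q + 4 * a) * p^4
       - b * (
         (14 * a + 2 * ac) * q + 2 * a^2 + 12 * ac * a - 8 * b^2 + 2 * ac^2 + bc^2) * p^3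
       + bc * (
         4 * a * q^2 + (20 * a^2 + 20 * ac * a - 7 * b^2) * q + 4 * a^3 + 24 * ac * a^2
         + (-24 * b^2 + 4 * ac^2 + 3 * bc^2) * a - ac * b^2) * p^2
       + b * (
         32 * ac * a * q^2
         + (56 * ac * a^2 + (8 * ac^2 + 26 * bc^2) * a - 6 * ac * b^2) * q + 8 * ac * a^3
         + (16 * ac^2 + 26 * bc^2) * a^2 + (-18 * ac * b^2 + 8 * ac^3 + 2 * bc^2 * ac) * a
         + (-6 * ac^2 - bc^2) * b^2) * p
       - bc * (
         80 * ac * a^2 * q^2
         + 4 * a * (20 * ac * a^2 + (16 * ac^2 + 6 * bc^2) * a - 3 * ac * b^2) * q
         + 16 * ac * a^4 + (32 * ac^2 + 12 * bc^2) * a^3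
         + (-28 * ac * b^2 + 16 * ac^3 + 16 * bc^2 * ac) * a^2
         + (-24 * ac^2 - bc^2) * b^2 * a - ac * b^4))"

definition W2 :: "complex \<Rightarrow> complex \<Rightarrow> complex \<Rightarrow> complex \<Rightarrow> complex \<Rightarrow> complex \<Rightarrow> complex" where
  "W2 a ac b bc p q =
     2 * (
       ((3 * a - ac) * q - 3 * b^2) * p^4 + b * bc * (3 * q + 9 * a + ac) * p^3
       + (
         -2 * (6 * a^2 + 2 * ac * a - b^2) * q^2
         - (
           4 * a^3 + 16 * ac * a^2 + (-27 * b^2 - 4 * ac^2 + 9 * bc^2) * a + 4 * ac * b^2) * q
         + 3 * (b^2 - 3 * bc^2) * a^2 + (9 * ac * b^2 - bc^2 * ac) * a - 7 * b^4
         + 2 * ac^2 * b^2) * p^2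
       - b * bc * (
         28 * a * q^2 + (60 * a^2 - 5 * b^2) * q + 8 * a^3 + 20 * ac * a^2
         - (19 * b^2 - 12 * ac^2) * a - 5 * ac * b^2) * p
       + 32 * ac * a^2 * q^3
       + 4 * a * (12 * ac * a^2 + (4 * ac^2 + 11 * bc^2) * a - 3 * ac * b^2) * q^2
       + (
         16 * ac * a^4 + (16 * ac^2 + 44 * bc^2) * a^3
         + (-32 * ac * b^2 + 40 * bc^2 * ac) * a^2 - (12 * ac^2 + 9 * bc^2) * b^2 * a
         + ac * b^4) * q
       + 8 * bc^2 * a^4 + (-4 * ac * b^2 + 20 * bc^2 * ac) * a^3
       + (-(4 * ac^2 + 15 * bc^2) * b^2 + 12 * bc^2 * ac^2 + 3 * bc^4) * a^2
       + (5 * ac * b^4 - 15 * bc^2 * ac * b^2) * a + 2 * ac^2 * b^4)"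

definition W1 :: "complex \<Rightarrow> complex \<Rightarrow> complex \<Rightarrow> complex \<Rightarrow> complex \<Rightarrow> complex \<Rightarrow> complex" where
  "W1 a ac b bc p q =
     2 * (
       2 * b * (q^2 + (3 * a - ac) * q - b^2) * p^3
       - bc * (
         8 * a * q^2 + (12 * a^2 - 4 * ac * a + b^2) * q - 6 * b^2 * a - 2 * ac * b^2) * p^2
       - b * (
         8 * a * q^3 + (32 * a^2 - 8 * ac * a - 2 * b^2) * q^2
         + (8 * a^3 + 8 * ac * a^2 + (-20 * b^2 - 2 * bc^2) * a + 2 * ac * b^2) * q
         + (-2 * b^2 + 6 * bc^2) * a^2 + (-2 * ac * b^2 + 6 * bc^2 * ac) * a + 3 * b^4
         - bc^2 * b^2) * p
       + bc * (
         32 * a^2 * q^3 + 4 * a * (12 * a^2 + 4 * ac * a - 3 * b^2) * q^2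
         + (
           16 * a^4 + 16 * ac * a^3 + (-32 * b^2 + 8 * bc^2) * a^2 - 12 * ac * b^2 * a
           + b^4) * q
         + (-4 * b^2 + 4 * bc^2) * a^3 + (-4 * ac * b^2 + 4 * bc^2 * ac) * a^2
         + (5 * b^4 - 3 * bc^2 * b^2) * a + 2 * ac * b^4))"

definition W0 :: "complex \<Rightarrow> complex \<Rightarrow> complex \<Rightarrow> complex \<Rightarrow> complex \<Rightarrow> complex \<Rightarrow> complex" where
  "W0 a ac b bc p q =
     q^2 * p^4 - 2 * bc * b * q * p^3
     + (
       -8 * a * q^3 + (-8 * a^2 + 2 * b^2) * q^2 + (6 * b^2 + 2 * bc^2) * a * q - b^4
       + bc^2 * b^2) * p^2
     + 2 * b * bc * (4 * a * q^2 + (-4 * a^2 - b^2) * q + (b^2 - bc^2) * a) * p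
     + 16 * a^2 * q^4 + 8 * a * (4 * a^2 - b^2) * q^3
     + (16 * a^4 + (-32 * b^2 + 8 * bc^2) * a^2 + b^4) * q^2
     - 2 * a * ((4 * b^2 - 4 * bc^2) * a^2 - 5 * b^4 + 3 * bc^2 * b^2) * q
     + (b - bc) * (b + bc) * ((b^2 - bc^2) * a^2 - b^4)"

definition F4 :: "complex \<Rightarrow> complex \<Rightarrow> real \<Rightarrow> real \<Rightarrow> complex \<Rightarrow> complex" where
  "F4 a b p q z =
     (let w = (\<lambda>W. W a (cnj a) b (cnj b) (of_real p) (of_real q)) in
      w W6 * z^6 + w W5 * z^5 + w W4 * z^4 + w W3 * z^3 + w W2 * z^2 + w W1 * z + w W0)"

lemma e_fun_factor:
  "e_fun r z = of_real
     (((cmod (z - 1) + cmod (z + 1))^2 - r^2) * ((cmod (z - 1) - cmod (z + 1))^2 - r^2) / 4)"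
proof -
  obtain x y where z: "z = Complex x y" by (cases z)
  define u v where "u = cmod (z - 1)" and "v = cmod (z + 1)"
  have u: "u^2 = (x-1)^2 + y^2" and v: "v^2 = (x+1)^2 + y^2"
    unfolding u_def v_def z by (simp_all add: cmod_power2)
  have "((u + v)^2 - r^2) * ((u - v)^2 - r^2) = (u^2 - v^2)^2 - 2 * r^2 * (u^2 + v^2) + r^4"
    by algebra
  also have "\<dots> = 16 * x^2 - 4 * r^2 * (x^2 + y^2 + 1) + r^4"
    unfolding u v by algebra
  finally have "((u + v)^2 - r^2) * ((u - v)^2 - r^2) / 4 = 4 * x^2 - r^2 * (x^2 + y^2 + 1) + r^4 / 4"
    by simp
  moreover have "e_fun r z = of_real (4 * x^2 - r^2 * (x^2 + y^2 + 1) + r^4 / 4)"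
    by (simp add: e_fun_def z complex_eq_iff power2_eq_square power4_eq_xxxx algebra_simps)
  ultimately show ?thesis
    unfolding u_def v_def by simp
qed

text \<open>For \<open>r > 2\<close> the equation \<open>e = 0\<close> describes exactly the ellipse with foci \<open>1\<close>, \<open>-1\<close>
  and distance sum \<open>r\<close>.\<close>

lemma zero_set_e_fun:
  assumes "r > 2"
  shows "zero_set (e_fun r) = {z. cmod (z - 1) + cmod (z + 1) = r}"
proof -
  have "(cmod (z - 1) - cmod (z + 1))^2 \<noteq> r^2" for z :: complex
  proof -
    have "\<bar>cmod (z - 1) - cmod (z + 1)\<bar> \<le> cmod ((z - 1) - (z + 1))"
      by (rule norm_triangle_ineq3)
    then show ?thesis
      using assms by (auto simp: power2_eq_iff)
  qed
  moreover have "(cmod (z - 1) + cmod (z + 1))^2 = r^2 \<longleftrightarrow> cmod (z - 1) + cmod (z + 1) = r" for z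
    using assms by (intro power_eq_iff_eq_base) auto
  ultimately show ?thesis
    unfolding zero_set_def e_fun_factor of_real_eq_0_iff by simp
qed

end

theory Submission
  imports Defs
begin

text \<open>
  Write \<open>w\<close> for the conjugate of \<open>z\<close> and treat \<open>c\<close> and \<open>e\<close> as polynomials in independent
  variables \<open>z\<close> and \<open>w\<close>. On every ellipse of the confocal family
  \<open>(z\<^sup>2 - 1) e\<^sub>z\<^sup>2 = (w\<^sup>2 - 1) e\<^sub>w\<^sup>2\<close>; this no longer mentions \<open>r\<close>, and at a point of tangency it
  carries over to the parallel gradient of \<open>c\<close>. Thus \<open>w\<close> is a common root of \<open>c\<close> and of
  \<open>(z\<^sup>2 - 1) c\<^sub>z\<^sup>2 - (w\<^sup>2 - 1) c\<^sub>w\<^sup>2\<close>. Modulo \<open>c\<close> the latter can be reduced, without denominators, to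
  a polynomial of degree two in \<open>w\<close>, and \<open>F\<^sub>4\<close> is the resultant of the two quadratics.
\<close>

lemma resultant_quadratics_eq_0:
  fixes w :: "'a :: idom"
  assumes c: "c2 * w\<^sup>2 + c1 * w + c0 = 0" and l: "l2 * w\<^sup>2 + l1 * w + l0 = 0"
  shows "(c2 * l0 - c0 * l2)\<^sup>2 - (c2 * l1 - c1 * l2) * (c1 * l0 - c0 * l1) = 0"
proof -
  have 1: "c2 * l0 - c0 * l2 = - (c2 * l1 - c1 * l2) * w"
    using c l by algebra
  have 2: "(c2 * l0 - c0 * l2) * w = - (c1 * l0 - c0 * l1)"
    using c l by algebra
  show ?thesis
    using 1 2 by algebra
qed

lemma has_derivative_conic:
  fixes a b p q z :: complex
  shows "((\<lambda>z. cnj a * z\<^sup>2 + p * z * cnj z + a * (cnj z)\<^sup>2 + cnj b * z + b * cnj z + q) has_derivative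
     (\<lambda>h. (2 * cnj a * z + p * cnj z + cnj b) * h + (p * z + 2 * a * cnj z + b) * cnj h)) (at z)"
  by (auto intro!: derivative_eq_intros bounded_linear.has_derivative[OF bounded_linear_cnj]
      simp: algebra_simps power2_eq_square)

text \<open>The kernel of \<open>h \<mapsto> 2 Re (u h)\<close> is spanned by \<open>\<i> cnj u\<close>, unless \<open>u = 0\<close>.\<close>

lemma kernel_eq_imp_parallel:
  fixes u v z :: complex
  assumes "{w. u * (w - z) + cnj u * cnj (w - z) = 0} = {w. v * (w - z) + cnj v * cnj (w - z) = 0}"
  shows "v * cnj u = cnj v * u"
proof -
  have "z + \<i> * cnj u \<in> {w. u * (w - z) + cnj u * cnj (w - z) = 0}"
    by simp
  then have "v * (\<i> * cnj u) + cnj v * cnj (\<i> * cnj u) = 0"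
    unfolding assms by simp
  then have "\<i> * (v * cnj u - cnj v * u) = 0"
    by (simp add: algebra_simps)
  then show ?thesis
    by simp
qed

text \<open>\<open>a\<close>, \<open>B\<close>, \<open>C\<close> are the coefficients of
  \<open>c\<close> as a quadratic in \<open>w\<close>; \<open>l2\<close>, \<open>l1\<close>,
  \<open>l0\<close> are those of the reduced second quadratic.\<close>

lemma F4_eq_resultant:
  fixes a b z A B C M l0 l1 l2 :: complex and p q :: real
  defines "A \<equiv> 2 * cnj a * z + cnj b" and "B \<equiv> p * z + b" and "C \<equiv> cnj a * z\<^sup>2 + cnj b * z + q"
    and "M \<equiv> cnj b * z + 2 * complex_of_real q"
  defines "l0 \<equiv> A\<^sup>2 - B\<^sup>2 + z * A * M"
    and "l1 \<equiv> 2 * complex_of_real p * A - 4 * a * B - b * M + b * z * A + 2 * b * C"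
    and "l2 \<equiv> p\<^sup>2 - 4 * a\<^sup>2 - 2 * a * M - b\<^sup>2 + 2 * b * B"
  shows "F4 a b p q z = (a * l0 - C * l2)\<^sup>2 - (a * l1 - B * l2) * (B * l0 - C * l1)"
  unfolding F4_def Let_def W6_def W5_def W4_def W3_def W2_def W1_def W0_def
    A_def B_def C_def M_def l0_def l1_def l2_def of_real_power
  by algebra

theorem theorem4p6:
  fixes a b z :: complex and p q r :: real
  assumes "nondegenerate_conic (zero_set (c_fun a b p q))"
    and "r > 2"
    and "zero_set (e_fun r) \<noteq> zero_set (c_fun a b p q)"
    and "tangency_point (e_fun r) (c_fun a b p q) z"
  shows "F4 a b p q z = 0"
proof -
  define w :: complex where "w = cnj z"
  \<comment> \<open>This makes \<open>e\<close> the conic with \<open>a = 1\<close>,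
    \<open>b = 0\<close>, \<open>p = 2 * t\<close>, \<open>q = t^2 - 1\<close>.\<close>
  define t where "t = complex_of_real (1 - r\<^sup>2 / 2)"
  define u :: complex where "u = 2 * z + 2 * t * w"
  define v :: complex where "v = 2 * cnj a * z + p * w + cnj b"
  have cnj_u: "cnj u = 2 * w + 2 * t * z" and cnj_v: "cnj v = p * z + 2 * a * w + b"
    by (simp_all add: u_def v_def w_def t_def)
  have e_fun_eq: "e_fun r = (\<lambda>z. cnj 1 * z\<^sup>2 + 2 * t * z * cnj z + 1 * (cnj z)\<^sup>2 + cnj 0 * z + 0 * cnj z + (t\<^sup>2 - 1))"
    by (rule ext) (simp add: e_fun_def Let_def t_def power2_eq_square algebra_simps)
  have c_fun_eq: "c_fun a b p q = (\<lambda>z :: complex. cnj a * z\<^sup>2 + p * z * cnj z + a * (cnj z)\<^sup>2 + cnj b * z + b * cnj z + q)"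
    by (rule ext) (simp add: c_fun_def)
  have e': "frechet_derivative (e_fun r) (at z) = (\<lambda>h. u * h + cnj u * cnj h)"
    unfolding e_fun_eq
    using frechet_derivative_at[OF has_derivative_conic[of 1 "2 * t" 0 "t\<^sup>2 - 1" z]]
    by (simp add: cnj_u) (simp add: u_def w_def algebra_simps)
  have c': "frechet_derivative (c_fun a b p q) (at z) = (\<lambda>h. v * h + cnj v * cnj h)"
    using has_derivative_conic[of a p b q z, folded c_fun_eq]
    by (intro frechet_derivative_at[symmetric]) (simp only: cnj_v, simp only: v_def w_def)
  have e0: "z\<^sup>2 + w\<^sup>2 + 2 * t * z * w + t\<^sup>2 - 1 = 0" and c0: "c_fun a b p q z = 0"
    using assms(4) by (auto simp: tangency_point_def zero_set_def e_fun_eq w_def algebra_simps)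
  have "u \<noteq> 0"
    using assms(4) by (auto simp: tangency_point_def e')
  have parallel: "v * cnj u = cnj v * u"
    using assms(4) by (intro kernel_eq_imp_parallel[of u z]) (simp add: tangency_point_def tangent_line_def e' c')
  \<comment> \<open>\<open>e = 0\<close> gives \<open>u^2 = 4 * (1 - t^2) * (1 - w^2)\<close>; swap
    \<open>z\<close> and \<open>w\<close> for \<open>cnj u\<close>.\<close>
  have confocal: "(z\<^sup>2 - 1) * u\<^sup>2 = (w\<^sup>2 - 1) * (cnj u)\<^sup>2"
    unfolding cnj_u using e0 unfolding u_def by algebra
  have "u\<^sup>2 * ((z\<^sup>2 - 1) * v\<^sup>2 - (w\<^sup>2 - 1) * (cnj v)\<^sup>2) = 0"
    using confocal parallel by algebra
  with \<open>u \<noteq> 0\<close> have H: "(z\<^sup>2 - 1) * v\<^sup>2 - (w\<^sup>2 - 1) * (cnj v)\<^sup>2 = 0"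
    by simp
  define A B C M :: complex where "A = 2 * cnj a * z + cnj b" and "B = p * z + b"
    and "C = cnj a * z\<^sup>2 + cnj b * z + q" and "M = cnj b * z + 2 * complex_of_real q"
  note defs = A_def B_def C_def M_def
  have c: "a * w\<^sup>2 + B * w + C = 0"
    using c0 by (simp add: c_fun_def defs w_def algebra_simps)
  \<comment> \<open>In the multiplier of \<open>c\<close>, \<open>2 * a * w^2\<close> cancels
    \<open>w^4\<close> and \<open>w^3\<close>; \<open>z * A\<close> lowers the degrees in
    \<open>z\<close> of the remaining coefficients.\<close>
  have "(p\<^sup>2 - 4 * a\<^sup>2 - 2 * a * M - b\<^sup>2 + 2 * b * B) * w\<^sup>2
      + (2 * complex_of_real p * A - 4 * a * B - b * M + b * z * A + 2 * b * C) * w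
      + (A\<^sup>2 - B\<^sup>2 + z * A * M)
    = - ((z\<^sup>2 - 1) * v\<^sup>2 - (w\<^sup>2 - 1) * (cnj v)\<^sup>2)
      - 2 * (2 * a * w\<^sup>2 - z * A) * (a * w\<^sup>2 + B * w + C)"
    unfolding cnj_v unfolding v_def defs of_real_power by algebra
  also have "\<dots> = 0"
    using H c by simp
  finally have l: "(p\<^sup>2 - 4 * a\<^sup>2 - 2 * a * M - b\<^sup>2 + 2 * b * B) * w\<^sup>2
      + (2 * complex_of_real p * A - 4 * a * B - b * M + b * z * A + 2 * b * C) * w
      + (A\<^sup>2 - B\<^sup>2 + z * A * M) = 0" .
  from resultant_quadratics_eq_0[OF c l] show ?thesis
    unfolding F4_eq_resultant defs by simp
qed

end
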